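(* Let $n$ nodes be divided into $k$ classes of size $\frac nk$ each, let $p,q\in[0,1]$ be constants with $p+q\le1$, and let $\alpha_{r,n}\in(0,1]$ be a sparsity factor dependent on $n$. Consider the random $r$-uniform hypergraph in which each set of $r$ nodes is an edge, independently, with probability $\alpha_{r,n}(p+q)$ if all $r$ nodes belong to the same class, and with probability $\alpha_{r,n}q$ otherwise. With $d$ and $\delta$ as defined in the context, $$\delta=\frac{p\,\alpha_{r,n}\,n}{rkd}\binom{\frac nk-2}{r-2},$$ and hence the partitions are identifiable (i.e. $\delta>0$) for all $p>0$. Moreover, if $$\alpha_{r,n}\ge C\,\frac{k^{2r-1}n(\ln n)^2}{\binom nr}$$ for some absolute constant $C>0$, then the conditions of the general consistency theorem recalled in the context are satisfied, that is, $\delta>0$ and $d>C_0\frac{kn_1(\ln n)^2}{\delta^2n_k}$ (here $n_1=n_k=\frac nk$, and $C_0$ is the absolute constant of that theorem), and hence $$\mathsf{Err}(\psi,\psi')=O\left(\frac{k^{2r-2}n^2\ln n}{p^2\alpha_{r,n}\binom nr}\right)=o(n)$$ with probability $1-o(1)$, where $\psi'$ is the labelling returned by the spectral hypergraph partitioning algorithm described in the context.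
   Context: Let $\mathcal V=\{1,\dots,n\}$ and let $\psi:\mathcal V\to\{1,\dots,k\}$ be the true class labelling, with $\psi_i=\psi(i)$; $k$ may vary with $n$, and asymptotic notation refers to $n\to\infty$. Let $\xi_1,\xi_2,\dots$ enumerate the $r$-element subsets of $\mathcal V$, let $h_j\in\{0,1\}$ indicate that $\xi_j$ is an edge, and let $a_{\xi_j}\in\{0,1\}^n$ be the indicator vector of $\xi_j$. **Laplacians.** $D$ is diagonal with $D_{ii}=\sum_j h_j(a_{\xi_j})_i$, $A=\sum_j\frac{h_j}{r}a_{\xi_j}a_{\xi_j}^T$, $L=I-D^{-1/2}AD^{-1/2}$. Let $\mathcal D=\mathsf E[D]$, $\mathcal A=\mathsf E[A]$, $d=\min_i\mathcal D_{ii}$. **The quantity $\delta$.** $G\in\mathbb R^{k\times k}$ is the symmetric matrix with $G_{\psi_i\psi_j}=\mathcal A_{ij}$ for $i\ne j$ (this depends only on $\psi_i,\psi_j$), $J$ is the diagonal $n\times n$ matrix with $J_{ii}=G_{\psi_i\psi_i}-\mathcal A_{ii}$, and, with $n_{\psi_i}$ the size of the class of node $i$ and $\lambda_{\min}(G)$ the smallest eigenvalue of $G$, $$\delta=\Big(\lambda_{\min}(G)\min_{1\le i\le n}\frac{n_{\psi_i}}{\mathcal D_{ii}}\Big)-\max_{1\le i,j\le n}\Big|\frac{J_{ii}}{\mathcal D_{ii}}-\frac{J_{jj}}{\mathcal D_{jj}}\Big|.$$ **Algorithm.** Let $X\in\mathbb R^{n\times k}$ have as columns orthonormal eigenvectors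 of $L$ for its $k$ smallest eigenvalues; let $\overline X$ be $X$ with rows normalized to unit Euclidean norm; run approximate $k$-means on the rows of $\overline X$, obtaining $S^*\in\mathcal M_{n\times k}(k)$, where $\mathcal M_{n\times k}(t)$ is the set of real $n\times k$ matrices with at most $t$ distinct rows (the rows of $S^*$ are the centers of the clusters). The labels $\psi'$ are the resulting clusters. The $k$-means method is that of Ostrovsky et al. (J. ACM 2012), which has the following guarantee: with $\eta_t(\overline X)=\min_{S\in\mathcal M_{n\times k}(t)}\|\overline X-S\|_F$, if $\eta_k(\overline X)\le\epsilon\,\eta_{k-1}(\overline X)$ for small enough $\epsilon$, then with probability $1-O(\sqrt\epsilon)$, $\|\overline X-S^*\|_F\le\gamma\,\eta_k(\overline X)$ with $\gamma=\sqrt{\frac{1-\epsilon^2}{1-37\epsilon^2}}$. **Error.** $\mathsf{Err}(\psi,\psi')=\min_\sigma\sum_{i=1}^n\mathbf 1\{\psi_i\ne\sigma(\psi'_i)\}$, the minimum over permutations $\sigma$ of the labels. **General consistency theorem.** For the general planted partition model with class sizes $n_1\ge\dots\ge n_k$ and sufficiently large $n$, there is an absolute constant $C_0>0$ such that if $\delta>0$ and $d>C_0\frac{kn_1(\ln n)^2}{\delta^2n_k}$, then $\mathsf{Err}(\psi,\psi')=O\big(\frac{kn_1\ln n}{\delta^2d}\big)$ with probability at least $1-O((\ln n)^{-1/4})$.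
   Formalization: C may depend on p (and C_0), since no C independent of p works for small p; k ≥ 2 and n/k ≥ 2 are assumed (for k = 1, q > 0 the δ formula fails); δ > 0 is claimed for r ≤ n/k (otherwise the binomial vanishes); p > 0 in the second part. *)

theory Defs
  imports
    "HOL-Probability.Probability"
    "HOL-Probability.Product_PMF"
    "HOL-Library.Landau_Symbols"
    "HOL-Combinatorics.Permutations"
    "Jordan_Normal_Form.Spectral_Radius"
begin

text \<open>
  Nodes are \<open>{..<n}\<close> and class labels are \<open>{..<k}\<close>. Matrices are those of
  Jordan\_Normal\_Form, whose dimensions are values, since \<open>n\<close> and \<open>k\<close> vary.
  A hypergraph on the node set is a function \<open>h :: nat set \<Rightarrow> bool\<close> marking which of the
  \<open>r\<close>-element sets of nodes are edges.
\<close>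

hide_const (open) Finite_Cartesian_Product.vec Finite_Cartesian_Product.mat
  Finite_Cartesian_Product.row

definition r_subsets :: "nat \<Rightarrow> nat \<Rightarrow> nat set set" where
  "r_subsets n r = {e. e \<subseteq> {..<n} \<and> card e = r}"

text \<open>
  General planted partition model: each \<open>r\<close>-set is an edge independently, with a probability that
  depends only on the multiset of labels of its nodes; \<open>B\<close> gives this probability.
\<close>

definition planted_hypergraph ::
    "nat \<Rightarrow> nat \<Rightarrow> (nat \<Rightarrow> nat) \<Rightarrow> (nat multiset \<Rightarrow> real) \<Rightarrow> (nat set \<Rightarrow> bool) pmf" where
  "planted_hypergraph n r \<psi> B =
     Pi_pmf (r_subsets n r) False (\<lambda>e. bernoulli_pmf (B (image_mset \<psi> (mset_set e))))"

definition two_level_prob :: "real \<Rightarrow> real \<Rightarrow> real \<Rightarrow> nat multiset \<Rightarrow> real" where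
  "two_level_prob p q \<alpha> M = (if \<exists>c. set_mset M = {c} then \<alpha> * (p + q) else \<alpha> * q)"

definition class_size :: "nat \<Rightarrow> (nat \<Rightarrow> nat) \<Rightarrow> nat \<Rightarrow> nat" where
  "class_size n \<psi> c = card {i \<in> {..<n}. \<psi> i = c}"

definition max_class_size :: "nat \<Rightarrow> nat \<Rightarrow> (nat \<Rightarrow> nat) \<Rightarrow> nat" where
  "max_class_size n k \<psi> = Max (class_size n \<psi> ` {..<k})"

definition min_class_size :: "nat \<Rightarrow> nat \<Rightarrow> (nat \<Rightarrow> nat) \<Rightarrow> nat" where
  "min_class_size n k \<psi> = Min (class_size n \<psi> ` {..<k})"

definition balanced_partition :: "nat \<Rightarrow> nat \<Rightarrow> (nat \<Rightarrow> nat) \<Rightarrow> bool" where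
  "balanced_partition n k \<psi> \<longleftrightarrow>
     k dvd n \<and> \<psi> ` {..<n} \<subseteq> {..<k} \<and> (\<forall>c<k. class_size n \<psi> c = n div k)"


definition incidence_vec :: "nat \<Rightarrow> nat set \<Rightarrow> real vec" where
  "incidence_vec n e = vec n (\<lambda>i. of_bool (i \<in> e))"

definition node_degree :: "nat \<Rightarrow> nat \<Rightarrow> (nat set \<Rightarrow> bool) \<Rightarrow> nat \<Rightarrow> real" where
  "node_degree n r h i = (\<Sum>e\<in>r_subsets n r. of_bool (h e) * incidence_vec n e $ i)"

definition adjacency :: "nat \<Rightarrow> nat \<Rightarrow> (nat set \<Rightarrow> bool) \<Rightarrow> real mat" where
  "adjacency n r h = mat n n (\<lambda>(i, j).
     \<Sum>e\<in>r_subsets n r. of_bool (h e) / real r * (incidence_vec n e $ i * incidence_vec n e $ j))"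

text \<open>For an isolated node the entry of \<open>D\<^sup>-\<^sup>1\<^sup>/\<^sup>2\<close> is \<open>1 / sqrt 0 = 0\<close>.\<close>

definition inv_sqrt_degree_mat :: "nat \<Rightarrow> nat \<Rightarrow> (nat set \<Rightarrow> bool) \<Rightarrow> real mat" where
  "inv_sqrt_degree_mat n r h = mat n n (\<lambda>(i, j). if i = j then 1 / sqrt (node_degree n r h i) else 0)"

definition laplacian :: "nat \<Rightarrow> nat \<Rightarrow> (nat set \<Rightarrow> bool) \<Rightarrow> real mat" where
  "laplacian n r h =
     1\<^sub>m n - inv_sqrt_degree_mat n r h * adjacency n r h * inv_sqrt_degree_mat n r h"

definition expected_degree ::
    "nat \<Rightarrow> nat \<Rightarrow> (nat \<Rightarrow> nat) \<Rightarrow> (nat multiset \<Rightarrow> real) \<Rightarrow> nat \<Rightarrow> real" where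
  "expected_degree n r \<psi> B i =
     measure_pmf.expectation (planted_hypergraph n r \<psi> B) (\<lambda>h. node_degree n r h i)"

definition expected_adjacency ::
    "nat \<Rightarrow> nat \<Rightarrow> (nat \<Rightarrow> nat) \<Rightarrow> (nat multiset \<Rightarrow> real) \<Rightarrow> real mat" where
  "expected_adjacency n r \<psi> B = mat n n (\<lambda>(i, j).
     measure_pmf.expectation (planted_hypergraph n r \<psi> B) (\<lambda>h. adjacency n r h $$ (i, j)))"

definition min_expected_degree ::
    "nat \<Rightarrow> nat \<Rightarrow> (nat \<Rightarrow> nat) \<Rightarrow> (nat multiset \<Rightarrow> real) \<Rightarrow> real" where
  "min_expected_degree n r \<psi> B = Min (expected_degree n r \<psi> B ` {..<n})"

text \<open>
  \<open>G\<close> is determined by \<open>G\<^bsub>\<psi> i, \<psi> j\<^esub> = \<A>\<^bsub>i j\<^esub>\<close> for all \<open>i \<noteq> j\<close>, except for the diagonal entry of a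
  class with a single node, which the description of \<open>G\<close> leaves open and which \<open>THE\<close> then leaves
  unspecified as well.
\<close>

definition class_mat ::
    "nat \<Rightarrow> nat \<Rightarrow> nat \<Rightarrow> (nat \<Rightarrow> nat) \<Rightarrow> (nat multiset \<Rightarrow> real) \<Rightarrow> real mat" where
  "class_mat n k r \<psi> B = mat k k (\<lambda>(a, b).
     THE x. \<forall>i<n. \<forall>j<n. i \<noteq> j \<and> \<psi> i = a \<and> \<psi> j = b \<longrightarrow> expected_adjacency n r \<psi> B $$ (i, j) = x)"

definition J_diag ::
    "nat \<Rightarrow> nat \<Rightarrow> nat \<Rightarrow> (nat \<Rightarrow> nat) \<Rightarrow> (nat multiset \<Rightarrow> real) \<Rightarrow> nat \<Rightarrow> real" where
  "J_diag n k r \<psi> B i =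
     class_mat n k r \<psi> B $$ (\<psi> i, \<psi> i) - expected_adjacency n r \<psi> B $$ (i, i)"

definition lambda_min :: "real mat \<Rightarrow> real" where
  "lambda_min M = Min (spectrum M)"

definition delta ::
    "nat \<Rightarrow> nat \<Rightarrow> nat \<Rightarrow> (nat \<Rightarrow> nat) \<Rightarrow> (nat multiset \<Rightarrow> real) \<Rightarrow> real" where
  "delta n k r \<psi> B =
     lambda_min (class_mat n k r \<psi> B) *
       Min ((\<lambda>i. real (class_size n \<psi> (\<psi> i)) / expected_degree n r \<psi> B i) ` {..<n}) -
     Max ((\<lambda>(i, j). \<bar>J_diag n k r \<psi> B i / expected_degree n r \<psi> B i -
                      J_diag n k r \<psi> B j / expected_degree n r \<psi> B j\<bar>) ` ({..<n} \<times> {..<n}))"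


definition frobenius_norm :: "real mat \<Rightarrow> real" where
  "frobenius_norm M = sqrt (\<Sum>i<dim_row M. \<Sum>j<dim_col M. (M $$ (i, j))\<^sup>2)"

text \<open>
  The columns of \<open>X\<close> are orthonormal eigenvectors for the \<open>k\<close> smallest eigenvalues of \<open>L\<close>, counted
  with multiplicity: they are part of an orthonormal eigenbasis (the columns of \<open>Q\<close>) whose remaining
  members belong to eigenvalues that are at least as large.
\<close>

definition smallest_eigenvectors :: "nat \<Rightarrow> real mat \<Rightarrow> real mat \<Rightarrow> bool" where
  "smallest_eigenvectors k L X \<longleftrightarrow>
     (let n = dim_row L in
      \<exists>Q \<mu>. Q \<in> carrier_mat n n \<and> transpose_mat Q * Q = 1\<^sub>m n \<and>
        (\<forall>i<n. L *\<^sub>v col Q i = \<mu> i \<cdot>\<^sub>v col Q i) \<and>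
        (\<forall>i j. i < k \<and> k \<le> j \<and> j < n \<longrightarrow> \<mu> i \<le> \<mu> j) \<and>
        X \<in> carrier_mat n k \<and> (\<forall>i<k. col X i = col Q i))"

text \<open>An implementation of the eigenvector step, resolving the non-uniqueness in some way.\<close>

definition eigenvector_method :: "(nat \<Rightarrow> real mat \<Rightarrow> real mat) \<Rightarrow> bool" where
  "eigenvector_method eig \<longleftrightarrow>
     (\<forall>n k L. L \<in> carrier_mat n n \<and> transpose_mat L = L \<and> k \<le> n \<longrightarrow>
        smallest_eigenvectors k L (eig k L))"

definition normalize_rows :: "real mat \<Rightarrow> real mat" where
  "normalize_rows X = mat (dim_row X) (dim_col X)
     (\<lambda>(i, j). X $$ (i, j) / sqrt (\<Sum>l<dim_col X. (X $$ (i, l))\<^sup>2))"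

definition mats_with_rows :: "nat \<Rightarrow> nat \<Rightarrow> nat \<Rightarrow> real mat set" where
  "mats_with_rows n k t = {S \<in> carrier_mat n k. card (set (rows S)) \<le> t}"

definition kmeans_cost :: "nat \<Rightarrow> real mat \<Rightarrow> real" where
  "kmeans_cost t X = (INF S\<in>mats_with_rows (dim_row X) (dim_col X) t. frobenius_norm (X - S))"

text \<open>
  A randomized approximate \<open>k\<close>-means method sends an \<open>n \<times> k\<close> matrix to a random matrix
  with at most \<open>k\<close> distinct rows. The bound \<open>\<epsilon>0\<close> makes ``small enough'' precise, and \<open>c\<close> is the
  constant in the failure probability \<open>O(sqrt \<epsilon>)\<close>; neither depends on the input. The guarantee
  involves \<open>\<eta>\<^bsub>k-1\<^esub>\<close> and hence needs \<open>k \<ge> 2\<close>.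
\<close>

definition kmeans_guarantee :: "(real mat \<Rightarrow> real mat pmf) \<Rightarrow> bool" where
  "kmeans_guarantee km \<longleftrightarrow>
     (\<forall>n k X. X \<in> carrier_mat n k \<and> 1 \<le> k \<longrightarrow> set_pmf (km X) \<subseteq> mats_with_rows n k k) \<and>
     (\<exists>\<epsilon>0>0. \<exists>c>0. 37 * \<epsilon>0\<^sup>2 < 1 \<and>
        (\<forall>n k X \<epsilon>. X \<in> carrier_mat n k \<and> 2 \<le> k \<and> 0 < \<epsilon> \<and> \<epsilon> \<le> \<epsilon>0 \<and>
            kmeans_cost k X \<le> \<epsilon> * kmeans_cost (k - 1) X \<longrightarrow>
          measure_pmf.prob (km X)
            {S. frobenius_norm (X - S) \<le> sqrt ((1 - \<epsilon>\<^sup>2) / (1 - 37 * \<epsilon>\<^sup>2)) * kmeans_cost k X}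
          \<ge> 1 - c * sqrt \<epsilon>))"

text \<open>
  Two nodes are in the same cluster iff they have the same center. Which label in \<open>{..<k}\<close> each
  cluster receives is immaterial, since the error is minimized over permutations of the labels.
\<close>

definition cluster_labels :: "nat \<Rightarrow> real mat \<Rightarrow> nat \<Rightarrow> nat" where
  "cluster_labels k S = (SOME l. (\<forall>i<dim_row S. l i < k) \<and>
     (\<forall>i<dim_row S. \<forall>j<dim_row S. l i = l j \<longleftrightarrow> row S i = row S j))"

definition spectral_partition ::
    "(nat \<Rightarrow> real mat \<Rightarrow> real mat) \<Rightarrow> (real mat \<Rightarrow> real mat pmf) \<Rightarrow>
     nat \<Rightarrow> nat \<Rightarrow> nat \<Rightarrow> (nat set \<Rightarrow> bool) \<Rightarrow> (nat \<Rightarrow> nat) pmf" where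
  "spectral_partition eig km n k r h =
     map_pmf (cluster_labels k) (km (normalize_rows (eig k (laplacian n r h))))"

text \<open>
  The distribution of the computed labelling, over the randomness of both the hypergraph and the
  \<open>k\<close>-means method.
\<close>

definition output_labelling ::
    "(nat \<Rightarrow> real mat \<Rightarrow> real mat) \<Rightarrow> (real mat \<Rightarrow> real mat pmf) \<Rightarrow>
     nat \<Rightarrow> nat \<Rightarrow> nat \<Rightarrow> (nat \<Rightarrow> nat) \<Rightarrow> (nat multiset \<Rightarrow> real) \<Rightarrow> (nat \<Rightarrow> nat) pmf" where
  "output_labelling eig km n k r \<psi> B =
     bind_pmf (planted_hypergraph n r \<psi> B) (spectral_partition eig km n k r)"

definition Err :: "nat \<Rightarrow> nat \<Rightarrow> (nat \<Rightarrow> nat) \<Rightarrow> (nat \<Rightarrow> nat) \<Rightarrow> nat" where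
  "Err n k \<psi> \<psi>' =
     Min ((\<lambda>\<sigma>. \<Sum>i<n. of_bool (\<psi> i \<noteq> \<sigma> (\<psi>' i))) ` {\<sigma>. \<sigma> permutes {..<k}})"


definition consistency_conditions ::
    "real \<Rightarrow> nat \<Rightarrow> nat \<Rightarrow> nat \<Rightarrow> (nat \<Rightarrow> nat) \<Rightarrow> (nat multiset \<Rightarrow> real) \<Rightarrow> bool" where
  "consistency_conditions C0 n k r \<psi> B \<longleftrightarrow>
     delta n k r \<psi> B > 0 \<and>
     min_expected_degree n r \<psi> B >
       C0 * (real k * real (max_class_size n k \<psi>) * (ln (real n))\<^sup>2 /
             ((delta n k r \<psi> B)\<^sup>2 * real (min_class_size n k \<psi>)))"

text \<open>
  The general consistency theorem, with \<open>C0\<close> as its absolute constant. The constants \<open>K\<close> and \<open>K'\<close>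
  in its asymptotic bounds and the threshold \<open>N\<close> for ``sufficiently large \<open>n\<close>'' depend only on the
  \<open>k\<close>-means method, not on the model.
\<close>

definition general_consistency_theorem :: "real \<Rightarrow> bool" where
  "general_consistency_theorem C0 \<longleftrightarrow>
     (\<forall>km. kmeans_guarantee km \<longrightarrow>
       (\<exists>K>0. \<exists>K'>0. \<exists>N. \<forall>n\<ge>N. \<forall>k r \<psi> B eig.
          1 \<le> k \<and> 2 \<le> r \<and> \<psi> ` {..<n} = {..<k} \<and> (\<forall>M. 0 \<le> B M \<and> B M \<le> 1) \<and>
          eigenvector_method eig \<and> consistency_conditions C0 n k r \<psi> B \<longrightarrow>
          measure_pmf.prob (output_labelling eig km n k r \<psi> B)
            {\<psi>'. real (Err n k \<psi> \<psi>') \<le>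
                   K * (real k * real (max_class_size n k \<psi>) * ln (real n) /
                        ((delta n k r \<psi> B)\<^sup>2 * min_expected_degree n r \<psi> B))}
          \<ge> 1 - K' * ln (real n) powr (- 1 / 4)))"

end

theory Submission
  imports Defs
begin

text \<open>
  By linearity of expectation all expected degrees equal
  \<open>d = \<alpha> q (n-1 choose r-1) + \<alpha> p (s-1 choose r-1)\<close> with \<open>s = n / k\<close>, so that the term with \<open>J\<close> vanishes,
  and \<open>G\<close> is a nonnegative constant matrix plus \<open>y\<close> times the identity, where
  \<open>y = \<alpha> p (s-2 choose r-2) / r\<close>. As \<open>k \<ge> 2\<close>, its smallest eigenvalue is \<open>y\<close>, whence \<open>\<delta> = y s / d\<close>.

  Then \<open>\<delta>\<^sup>2 d = (y s)\<^sup>2 / d\<close>. Since \<open>p + q \<le> 1\<close>, \<open>d\<close> is at most \<open>\<alpha> r (n choose r) / n\<close>, and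
  \<open>y s \<ge> \<alpha> p (r-1) (s choose r) / s\<close>. The lower bound on \<open>\<alpha>\<close>, together with \<open>\<alpha> \<le> 1\<close>, forces
  \<open>s \<rightarrow> \<infinity>\<close>, so \<open>(n choose r) \<le> 2 k\<^sup>r (s choose r)\<close> eventually. Hence \<open>\<delta>\<^sup>2 d\<close> is at least a constant
  times \<open>p\<^sup>2 \<alpha> (n choose r) / (k\<^bsup>2r-2\<^esup> n)\<close>, from which both the conditions of the general theorem and
  the form of its error bound follow.
\<close>

unbundle no vec_syntax

section \<open>Counting \<open>r\<close>-sets between two node sets\<close>

lemma finite_r_subsets [simp]: "finite (r_subsets n r)"
  by (rule finite_subset[of _ "Pow {..<n}"]) (auto simp: r_subsets_def)

text \<open>Removing \<open>T\<close> is a bijection onto the subsets of \<open>U - T\<close> of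
  size \<open>r - card T\<close>. With \<open>U\<close> the set of all nodes this counts the
  possible edges through \<open>T\<close>, with \<open>U\<close> a class those that stay inside the
  class.\<close>

lemma card_r_subsets_between:
  assumes "T \<subseteq> U" "U \<subseteq> {..<n}" "card T \<le> r"
  shows "card {e \<in> r_subsets n r. T \<subseteq> e \<and> e \<subseteq> U} = (card U - card T) choose (r - card T)"
proof -
  have fU: "finite U" using assms(2) by (rule finite_subset) simp
  have fT: "finite T" using assms(1) fU by (rule finite_subset)
  have "bij_betw (\<lambda>F. F \<union> T) {F. F \<subseteq> U - T \<and> card F = r - card T}
          {e \<in> r_subsets n r. T \<subseteq> e \<and> e \<subseteq> U}"
  proof (rule bij_betw_byWitness[where f' = "\<lambda>e. e - T"])
    show "(\<lambda>F. F \<union> T) ` {F. F \<subseteq> U - T \<and> card F = r - card T}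
            \<subseteq> {e \<in> r_subsets n r. T \<subseteq> e \<and> e \<subseteq> U}"
    proof safe
      fix F assume F: "F \<subseteq> U - T" "card F = r - card T"
      have "finite F" using F(1) fU by (meson finite_Diff finite_subset)
      then have "card (F \<union> T) = card F + card T"
        using F(1) fT by (intro card_Un_disjoint) auto
      then show "F \<union> T \<in> r_subsets n r"
        using F assms by (auto simp: r_subsets_def)
    qed (use assms in auto)
    show "(\<lambda>e. e - T) ` {e \<in> r_subsets n r. T \<subseteq> e \<and> e \<subseteq> U}
            \<subseteq> {F. F \<subseteq> U - T \<and> card F = r - card T}"
      using fT by (auto simp: r_subsets_def card_Diff_subset)
  qed auto
  then have "card {e \<in> r_subsets n r. T \<subseteq> e \<and> e \<subseteq> U}
      = card {F. F \<subseteq> U - T \<and> card F = r - card T}"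
    by (simp add: bij_betw_same_card)
  also have "\<dots> = card (U - T) choose (r - card T)"
    using fU by (simp add: n_subsets)
  finally show ?thesis using fT assms(1) by (simp add: card_Diff_subset)
qed

section \<open>Expected degrees and adjacencies in the two-level model\<close>

lemma two_level_prob_bounds:
  assumes "0 \<le> p" "0 \<le> q" "p + q \<le> 1" "0 < \<alpha>" "\<alpha> \<le> 1"
  shows "0 \<le> two_level_prob p q \<alpha> M \<and> two_level_prob p q \<alpha> M \<le> 1"
proof -
  have "\<alpha> * (p + q) \<le> 1 * 1" "\<alpha> * q \<le> 1 * 1"
    using assms by (intro mult_mono; simp)+
  then show ?thesis using assms by (simp add: two_level_prob_def)
qed

text \<open>An edge has probability \<open>\<alpha> * q\<close>, plus \<open>\<alpha> * p\<close> if
  it lies in one class; an edge through \<open>i\<close> lies in one class iff it lies in the class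
  of \<open>i\<close>. So both contributions are counts of \<open>r\<close>-sets between
  \<open>T\<close> and a larger set. A single node as \<open>T\<close> gives the expected degrees, a
  pair the off-diagonal expected adjacencies.\<close>

lemma sum_two_level_prob:
  assumes "T \<subseteq> {..<n}" "i \<in> T" "card T \<le> r"
  shows "(\<Sum>e | e \<in> r_subsets n r \<and> T \<subseteq> e.
            two_level_prob p q \<alpha> (image_mset \<psi> (mset_set e))) =
         \<alpha> * q * real ((n - card T) choose (r - card T)) +
         (if \<psi> ` T = {\<psi> i} then \<alpha> * p *
            real ((class_size n \<psi> (\<psi> i) - card T) choose (r - card T)) else 0)"
proof -
  let ?E = "{e. e \<in> r_subsets n r \<and> T \<subseteq> e}"
  let ?U = "{j \<in> {..<n}. \<psi> j = \<psi> i}"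
  have fin: "finite ?E" by simp
  have mono: "(\<exists>c. set_mset (image_mset \<psi> (mset_set e)) = {c}) \<longleftrightarrow> e \<subseteq> ?U" if "e \<in> ?E" for e
  proof -
    have "finite e" "i \<in> e" "e \<subseteq> {..<n}"
      using that assms(2) by (auto simp: r_subsets_def intro: finite_subset)
    have "set_mset (image_mset \<psi> (mset_set e)) = \<psi> ` e" "\<psi> i \<in> \<psi> ` e"
      using \<open>finite e\<close> \<open>i \<in> e\<close> by auto
    moreover have "(\<exists>c. \<psi> ` e = {c}) \<longleftrightarrow> e \<subseteq> ?U"
    proof
      assume "\<exists>c. \<psi> ` e = {c}"
      then obtain c where c: "\<psi> ` e = {c}" ..
      with \<open>\<psi> i \<in> \<psi> ` e\<close> have "\<psi> i = c" by simp
      with c have "\<psi> ` e = {\<psi> i}" by simp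
      then show "e \<subseteq> ?U" using \<open>e \<subseteq> {..<n}\<close> by auto
    next
      assume "e \<subseteq> ?U"
      with \<open>i \<in> e\<close> have "\<psi> ` e = {\<psi> i}" by auto
      then show "\<exists>c. \<psi> ` e = {c}" ..
    qed
    ultimately show ?thesis by simp
  qed
  have "(\<Sum>e\<in>?E. two_level_prob p q \<alpha> (image_mset \<psi> (mset_set e)))
      = (\<Sum>e\<in>?E. \<alpha> * q + (if e \<subseteq> ?U then \<alpha> * p else 0))"
  proof (rule sum.cong[OF refl])
    fix e assume "e \<in> ?E"
    from mono[OF this] show "two_level_prob p q \<alpha> (image_mset \<psi> (mset_set e))
        = \<alpha> * q + (if e \<subseteq> ?U then \<alpha> * p else 0)"
      unfolding two_level_prob_def by (simp only:) (simp add: algebra_simps)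
  qed
  also have "\<dots> = \<alpha> * q * real (card ?E) + \<alpha> * p * real (card {e \<in> ?E. e \<subseteq> ?U})"
    using sum.inter_filter[OF fin, of "\<lambda>_. \<alpha> * p" "\<lambda>e. e \<subseteq> ?U"]
    by (simp add: sum.distrib mult.commute)
  also have "card ?E = (n - card T) choose (r - card T)"
  proof -
    have "?E = {e \<in> r_subsets n r. T \<subseteq> e \<and> e \<subseteq> {..<n}}"
      by (auto simp: r_subsets_def)
    then show ?thesis using card_r_subsets_between[of T "{..<n}" n r] assms by simp
  qed
  also have "{e \<in> ?E. e \<subseteq> ?U} = {e \<in> r_subsets n r. T \<subseteq> e \<and> e \<subseteq> ?U}"
    by auto
  also have "\<alpha> * p * real (card \<dots>) =
      (if \<psi> ` T = {\<psi> i} then \<alpha> * p *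
            real ((class_size n \<psi> (\<psi> i) - card T) choose (r - card T)) else 0)"
  proof (cases "\<psi> ` T = {\<psi> i}")
    case True
    then have "T \<subseteq> ?U" using assms by auto
    then have "card {e \<in> r_subsets n r. T \<subseteq> e \<and> e \<subseteq> ?U} = (card ?U - card T) choose (r - card T)"
      using assms by (intro card_r_subsets_between) auto
    then show ?thesis using True by (simp add: class_size_def)
  next
    case False
    then have "\<not> T \<subseteq> ?U" using assms(2) by auto
    then have "{e \<in> r_subsets n r. T \<subseteq> e \<and> e \<subseteq> ?U} = {}" by auto
    then show ?thesis using False by (simp only: card.empty) simp
  qed
  finally show ?thesis .
qed

text \<open>Linearity of expectation reduces the claim to single edges, and each component of the
  product distribution is Bernoulli. The weight \<open>c\<close> serves degrees and adjacencies
  alike.\<close>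

lemma expectation_planted_hypergraph:
  assumes "\<And>M. 0 \<le> B M \<and> B M \<le> 1"
  shows "measure_pmf.expectation (planted_hypergraph n r \<psi> B)
           (\<lambda>h. \<Sum>e\<in>r_subsets n r. of_bool (h e) * c e) =
         (\<Sum>e\<in>r_subsets n r. B (image_mset \<psi> (mset_set e)) * (c e :: real))"
proof -
  let ?P = "planted_hypergraph n r \<psi> B"
  have int: "integrable ?P (\<lambda>h. of_bool (h e) :: real)" for e
    by (rule measure_pmf.integrable_const_bound[where B = 1]) auto
  have "measure_pmf.expectation ?P (\<lambda>h. of_bool (h e)) = B (image_mset \<psi> (mset_set e))"
    if e: "e \<in> r_subsets n r" for e
  proof -
    have "measure_pmf.expectation ?P (\<lambda>h. of_bool (h e) :: real)
        = measure_pmf.expectation (map_pmf (\<lambda>h. h e) ?P) of_bool"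
      by simp
    also have "map_pmf (\<lambda>h. h e) ?P = bernoulli_pmf (B (image_mset \<psi> (mset_set e)))"
      unfolding planted_hypergraph_def using e by (simp add: Pi_pmf_component)
    finally show ?thesis using assms by simp
  qed
  then show ?thesis
    using int by (subst Bochner_Integration.integral_sum) (auto simp del: of_bool_def intro!: sum.cong)
qed

lemma expected_degree_two_level:
  assumes "0 \<le> p" "0 \<le> q" "p + q \<le> 1" "0 < \<alpha>" "\<alpha> \<le> 1" "1 \<le> r" "i < n"
  shows "expected_degree n r \<psi> (two_level_prob p q \<alpha>) i =
         \<alpha> * q * real ((n - 1) choose (r - 1)) +
         \<alpha> * p * real ((class_size n \<psi> (\<psi> i) - 1) choose (r - 1))"
proof -
  have "expected_degree n r \<psi> (two_level_prob p q \<alpha>) i =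
      measure_pmf.expectation (planted_hypergraph n r \<psi> (two_level_prob p q \<alpha>))
        (\<lambda>h. \<Sum>e\<in>r_subsets n r. of_bool (h e) * of_bool (i \<in> e))"
    unfolding expected_degree_def node_degree_def
    using \<open>i < n\<close> by (simp add: incidence_vec_def)
  also have "\<dots> = (\<Sum>e\<in>r_subsets n r.
        two_level_prob p q \<alpha> (image_mset \<psi> (mset_set e)) * of_bool (i \<in> e))"
    using two_level_prob_bounds[OF assms(1-5)] by (rule expectation_planted_hypergraph)
  also have "\<dots> = (\<Sum>e | e \<in> r_subsets n r \<and> {i} \<subseteq> e.
        two_level_prob p q \<alpha> (image_mset \<psi> (mset_set e)))"
    by (intro sum.mono_neutral_cong_right) auto
  finally show ?thesis
    using sum_two_level_prob[of "{i}" n i r] assms by simp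
qed

lemma expected_adjacency_two_level:
  assumes "0 \<le> p" "0 \<le> q" "p + q \<le> 1" "0 < \<alpha>" "\<alpha> \<le> 1" "2 \<le> r" "i < n" "j < n" "i \<noteq> j"
  shows "expected_adjacency n r \<psi> (two_level_prob p q \<alpha>) $$ (i, j) =
         (\<alpha> * q * real ((n - 2) choose (r - 2)) +
          (if \<psi> i = \<psi> j then \<alpha> * p * real ((class_size n \<psi> (\<psi> i) - 2) choose (r - 2)) else 0)) /
         real r"
proof -
  have "expected_adjacency n r \<psi> (two_level_prob p q \<alpha>) $$ (i, j) =
      measure_pmf.expectation (planted_hypergraph n r \<psi> (two_level_prob p q \<alpha>))
        (\<lambda>h. \<Sum>e\<in>r_subsets n r. of_bool (h e) * (of_bool (i \<in> e \<and> j \<in> e) / real r))"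
    unfolding expected_adjacency_def adjacency_def
    using assms(7,8) by (simp add: incidence_vec_def of_bool_conj mult.assoc)
  also have "\<dots> = (\<Sum>e\<in>r_subsets n r. two_level_prob p q \<alpha> (image_mset \<psi> (mset_set e)) *
        (of_bool (i \<in> e \<and> j \<in> e) / real r))"
    using two_level_prob_bounds[OF assms(1-5)] by (rule expectation_planted_hypergraph)
  also have "\<dots> = (\<Sum>e | e \<in> r_subsets n r \<and> {i, j} \<subseteq> e.
        two_level_prob p q \<alpha> (image_mset \<psi> (mset_set e))) / real r"
    unfolding sum_divide_distrib by (intro sum.mono_neutral_cong_right) auto
  also have "(\<Sum>e | e \<in> r_subsets n r \<and> {i, j} \<subseteq> e.
        two_level_prob p q \<alpha> (image_mset \<psi> (mset_set e))) =
      \<alpha> * q * real ((n - 2) choose (r - 2)) +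
      (if \<psi> i = \<psi> j then \<alpha> * p * real ((class_size n \<psi> (\<psi> i) - 2) choose (r - 2)) else 0)"
    using sum_two_level_prob[of "{i, j}" n i r p q \<alpha> \<psi>] assms(6-9)
    by (auto simp: card_insert_if numeral_2_eq_2 split: if_splits)
  finally show ?thesis .
qed

text \<open>An indicator is its own square, so a diagonal adjacency entry is a degree divided by
  \<open>r\<close>. In the balanced model, where the expected degrees agree, this makes
  \<open>J_diag\<close> constant over the nodes.\<close>

lemma expected_adjacency_diag:
  assumes "\<And>M. 0 \<le> B M \<and> B M \<le> 1" "i < n"
  shows "expected_adjacency n r \<psi> B $$ (i, i) = expected_degree n r \<psi> B i / real r"
proof -
  have "expected_adjacency n r \<psi> B $$ (i, i) =
      measure_pmf.expectation (planted_hypergraph n r \<psi> B)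
        (\<lambda>h. \<Sum>e\<in>r_subsets n r. of_bool (h e) * (of_bool (i \<in> e) / real r))"
    unfolding expected_adjacency_def adjacency_def
    using assms(2) by (simp add: incidence_vec_def of_bool_conj[symmetric])
  also have "\<dots> = (\<Sum>e\<in>r_subsets n r. B (image_mset \<psi> (mset_set e)) * (of_bool (i \<in> e) / real r))"
    using assms(1) by (rule expectation_planted_hypergraph)
  also have "\<dots> = (\<Sum>e\<in>r_subsets n r. B (image_mset \<psi> (mset_set e)) * of_bool (i \<in> e)) / real r"
    unfolding sum_divide_distrib by simp
  also have "(\<Sum>e\<in>r_subsets n r. B (image_mset \<psi> (mset_set e)) * of_bool (i \<in> e)) =
      measure_pmf.expectation (planted_hypergraph n r \<psi> B)
        (\<lambda>h. \<Sum>e\<in>r_subsets n r. of_bool (h e) * of_bool (i \<in> e))"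
    using assms(1) by (rule expectation_planted_hypergraph[symmetric])
  also have "\<dots> = expected_degree n r \<psi> B i"
    unfolding expected_degree_def node_degree_def
    using assms(2) by (simp add: incidence_vec_def)
  finally show ?thesis .
qed

section \<open>Smallest eigenvalue of a constant matrix plus a scalar matrix\<close>

lemma lambda_min_const_plus_diag:
  fixes x y :: real
  assumes "0 \<le> x" "2 \<le> k"
  shows "lambda_min (mat k k (\<lambda>(a, b). x + (if a = b then y else 0))) = y"
proof -
  let ?M = "mat k k (\<lambda>(a, b). x + (if a = b then y else 0))"
  have mult: "(?M *\<^sub>v v) $ a = x * (\<Sum>b<k. v $ b) + y * v $ a"
    if "v \<in> carrier_vec k" "a < k" for v a
  proof -
    have "(?M *\<^sub>v v) $ a = (\<Sum>b<k. (x + (if a = b then y else 0)) * v $ b)"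
      using that by (auto simp: scalar_prod_def lessThan_atLeast0 intro!: sum.cong)
    also have "\<dots> = (\<Sum>b<k. x * v $ b) + (\<Sum>b<k. if a = b then y * v $ b else 0)"
      unfolding sum.distrib[symmetric] by (intro sum.cong) (auto simp: distrib_right)
    also have "(\<Sum>b<k. if a = b then y * v $ b else 0) = y * v $ a"
      using that by simp
    finally show ?thesis by (simp add: sum_distrib_left)
  qed
  have le: "y \<le> l" and two: "l \<in> {y, y + real k * x}" if l: "l \<in> spectrum ?M" for l
  proof -
    obtain v where v: "v \<in> carrier_vec k" "v \<noteq> 0\<^sub>v k" "?M *\<^sub>v v = l \<cdot>\<^sub>v v"
      using l by (auto simp: spectrum_def eigenvalue_def eigenvector_def)
    define S where "S = (\<Sum>b<k. v $ b)"
    have eq: "x * S + y * v $ a = l * v $ a" if "a < k" for a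
      using mult[OF v(1) that] v(1,3) that by (simp add: S_def)
    \<comment> \<open>Summing the coordinate equations leaves two cases: if \<open>S\<close> is
      nonzero then \<open>l = y + k * x\<close>, and if \<open>S = 0\<close> the equation at a
      nonzero coordinate of \<open>v\<close> gives \<open>l = y\<close>. As \<open>x\<close> is
      nonnegative, \<open>y\<close> is a lower bound.\<close>
    have "(\<Sum>a<k. x * S + y * v $ a) = (\<Sum>a<k. l * v $ a)"
      using eq by (intro sum.cong) auto
    then have sum: "(real k * x + y) * S = l * S"
      by (simp add: sum.distrib S_def[symmetric] sum_distrib_left[symmetric] algebra_simps)
    show two: "l \<in> {y, y + real k * x}"
    proof (cases "S = 0")
      case True
      obtain a where "a < k" "v $ a \<noteq> 0"
        using v(1,2) by (metis carrier_vecD eq_vecI index_zero_vec)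
      then show ?thesis using eq[of a] True by simp
    qed (use sum in auto)
    show "y \<le> l" using two assms by auto
  qed
  \<comment> \<open>The value \<open>y\<close> is attained at the difference of two unit vectors,
    whose coordinates sum to 0; this is where \<open>2 \<le> k\<close> enters.\<close>
  have "eigenvector ?M (vec k (\<lambda>a. if a = 0 then 1 else if a = 1 then - 1 else 0)) y"
    (is "eigenvector _ ?v _")
    unfolding eigenvector_def
  proof (intro conjI)
    show "?v \<in> carrier_vec (dim_row ?M)" by simp
    have "?v $ 0 \<noteq> 0\<^sub>v k $ 0" using assms by simp
    then show "?v \<noteq> 0\<^sub>v (dim_row ?M)" by auto
    have "(\<Sum>b<k. ?v $ b) = (\<Sum>b\<in>{0, 1}. ?v $ b)"
      using assms by (intro sum.mono_neutral_right) auto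
    also have "\<dots> = 0" using assms by simp
    finally have "(?M *\<^sub>v ?v) $ a = (y \<cdot>\<^sub>v ?v) $ a" if "a < k" for a
      using mult[of ?v a] that by simp
    then show "?M *\<^sub>v ?v = y \<cdot>\<^sub>v ?v" by (intro eq_vecI) auto
  qed
  then have "y \<in> spectrum ?M" by (auto simp: spectrum_def eigenvalue_def)
  moreover have "finite (spectrum ?M)"
    by (rule finite_subset[of _ "{y, y + real k * x}"]) (use two in auto)
  ultimately show ?thesis
    unfolding lambda_min_def using le by (intro Min_eqI) auto
qed

section \<open>The balanced model and the closed form of \<open>delta\<close>\<close>

locale balanced_two_level =
  fixes n k r :: nat and p q \<alpha> :: real and \<psi> :: "nat \<Rightarrow> nat"
  assumes k_ge: "2 \<le> k" and r_ge: "2 \<le> r" and s_ge: "2 \<le> n div k"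
    and balanced: "balanced_partition n k \<psi>"
    and p_nonneg: "0 \<le> p" and q_nonneg: "0 \<le> q" and pq_le: "p + q \<le> 1"
    and \<alpha>_pos: "0 < \<alpha>" and \<alpha>_le: "\<alpha> \<le> 1"
begin

abbreviation B where "B \<equiv> two_level_prob p q \<alpha>"
abbreviation s where "s \<equiv> n div k"
abbreviation d where "d \<equiv> min_expected_degree n r \<psi> B"

lemma B_bounds: "0 \<le> B M \<and> B M \<le> 1"
  by (rule two_level_prob_bounds[OF p_nonneg q_nonneg pq_le \<alpha>_pos \<alpha>_le])

lemma n_eq: "n = k * s"
  using balanced by (simp add: balanced_partition_def)

lemma n_pos: "0 < n"
  using n_eq k_ge s_ge by (metis gr0I div_0 not_numeral_le_zero)

lemma label_less: "i < n \<Longrightarrow> \<psi> i < k"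
  using balanced by (auto simp: balanced_partition_def)

lemma class_size_eq: "c < k \<Longrightarrow> class_size n \<psi> c = s"
  using balanced by (simp add: balanced_partition_def)

text \<open>For \<open>a = b\<close> two different nodes of one class are required, and they exist
  because classes have at least two nodes. Such a pair determines the entry of
  \<open>class_mat\<close> at \<open>(a, b)\<close>, also on the diagonal.\<close>

lemma ex_nodes:
  assumes "a < k" "b < k"
  obtains i j where "i < n" "j < n" "i \<noteq> j" "\<psi> i = a" "\<psi> j = b"
proof -
  have ge: "2 \<le> card {i \<in> {..<n}. \<psi> i = c}" if "c < k" for c
    using class_size_eq[OF that] s_ge by (simp add: class_size_def)
  from ge[OF assms(1)] have "{i \<in> {..<n}. \<psi> i = a} \<noteq> {}" by (intro notI) (simp only: card.empty)
  then obtain i where i: "i < n" "\<psi> i = a" by auto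
  have "\<not> {j \<in> {..<n}. \<psi> j = b} \<subseteq> {i}"
    using card_mono[of "{i}" "{j \<in> {..<n}. \<psi> j = b}"] ge[OF assms(2)] by auto
  then show ?thesis using that i by auto
qed

text \<open>Needed to apply \<open>general_consistency_theorem\<close>, which asks that every label
  occurs.\<close>

lemma labels_surj: "\<psi> ` {..<n} = {..<k}"
proof
  show "{..<k} \<subseteq> \<psi> ` {..<n}"
  proof
    fix c assume "c \<in> {..<k}"
    then show "c \<in> \<psi> ` {..<n}" using ex_nodes[of c c] by force
  qed
qed (use label_less in auto)

lemma extreme_class_sizes: "max_class_size n k \<psi> = s" "min_class_size n k \<psi> = s"
proof -
  have "class_size n \<psi> ` {..<k} = {s}"
    using class_size_eq k_ge by (auto simp: image_iff intro!: exI[of _ 0])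
  then show "max_class_size n k \<psi> = s" "min_class_size n k \<psi> = s"
    by (simp_all add: max_class_size_def min_class_size_def)
qed

lemma d_eq: "d = \<alpha> * q * real ((n - 1) choose (r - 1)) + \<alpha> * p * real ((s - 1) choose (r - 1))"
  and expected_degree_eq: "i < n \<Longrightarrow> expected_degree n r \<psi> B i = d"
proof -
  let ?D = "\<alpha> * q * real ((n - 1) choose (r - 1)) + \<alpha> * p * real ((s - 1) choose (r - 1))"
  have deg: "expected_degree n r \<psi> B i = ?D" if "i < n" for i
    using expected_degree_two_level[OF p_nonneg q_nonneg pq_le \<alpha>_pos \<alpha>_le _ that]
      r_ge class_size_eq[OF label_less[OF that]] by simp
  then have "expected_degree n r \<psi> B ` {..<n} = {?D}"
    using n_pos by (auto simp: image_iff)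
  then show d: "d = ?D" by (simp add: min_expected_degree_def)
  show "expected_degree n r \<psi> B i = d" if "i < n"
    using deg[OF that] d by simp
qed

lemma class_mat_eq:
  "class_mat n k r \<psi> B = mat k k (\<lambda>(a, b). \<alpha> * q * real ((n - 2) choose (r - 2)) / real r +
     (if a = b then \<alpha> * p * real ((s - 2) choose (r - 2)) / real r else 0))"
proof (rule eq_matI)
  fix a b
  assume "a < dim_row (mat k k (\<lambda>(a, b). \<alpha> * q * real ((n - 2) choose (r - 2)) / real r +
     (if a = b then \<alpha> * p * real ((s - 2) choose (r - 2)) / real r else 0)))"
    "b < dim_col (mat k k (\<lambda>(a, b). \<alpha> * q * real ((n - 2) choose (r - 2)) / real r +
     (if a = b then \<alpha> * p * real ((s - 2) choose (r - 2)) / real r else 0)))"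
  then have ab: "a < k" "b < k" by auto
  let ?x = "\<alpha> * q * real ((n - 2) choose (r - 2)) / real r +
     (if a = b then \<alpha> * p * real ((s - 2) choose (r - 2)) / real r else 0)"
  have entry: "expected_adjacency n r \<psi> B $$ (i, j) = ?x"
    if "i < n" "j < n" "i \<noteq> j" "\<psi> i = a" "\<psi> j = b" for i j
    using expected_adjacency_two_level[OF p_nonneg q_nonneg pq_le \<alpha>_pos \<alpha>_le r_ge that(1-3), of \<psi>]
      that(4,5) class_size_eq[OF ab(1)] by (auto simp: add_divide_distrib)
  obtain i j where ij: "i < n" "j < n" "i \<noteq> j" "\<psi> i = a" "\<psi> j = b"
    using ex_nodes[OF ab] .
  \<comment> \<open>All admissible pairs of nodes give the value \<open>?x\<close>; the pair
    \<open>i\<close>, \<open>j\<close> shows that there is one, so no other value fits the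
    description.\<close>
  have "(THE x. \<forall>i<n. \<forall>j<n. i \<noteq> j \<and> \<psi> i = a \<and> \<psi> j = b \<longrightarrow>
      expected_adjacency n r \<psi> B $$ (i, j) = x) = ?x"
    by (rule the_equality) (use entry ij in blast)+
  then show "class_mat n k r \<psi> B $$ (a, b) = mat k k (\<lambda>(a, b).
      \<alpha> * q * real ((n - 2) choose (r - 2)) / real r +
      (if a = b then \<alpha> * p * real ((s - 2) choose (r - 2)) / real r else 0)) $$ (a, b)"
    using ab by (simp add: class_mat_def)
qed (simp_all add: class_mat_def)

lemma delta_eq: "delta n k r \<psi> B =
    p * \<alpha> * real n / (real r * real k * d) * real ((s - 2) choose (r - 2))"
proof -
  have "lambda_min (class_mat n k r \<psi> B) = \<alpha> * p * real ((s - 2) choose (r - 2)) / real r"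
    unfolding class_mat_eq using q_nonneg \<alpha>_pos k_ge
    by (intro lambda_min_const_plus_diag) auto
  moreover have "(\<lambda>i. real (class_size n \<psi> (\<psi> i)) / expected_degree n r \<psi> B i) ` {..<n}
      = {real s / d}"
    using n_pos class_size_eq label_less expected_degree_eq
    by (auto simp: image_iff intro!: bexI[of _ 0])
  \<comment> \<open>The diagonal of \<open>class_mat\<close> and the expected degrees are both
    constant, so the maximum in \<open>delta\<close> runs over zeros only.\<close>
  moreover have "J_diag n k r \<psi> B i / expected_degree n r \<psi> B i =
      J_diag n k r \<psi> B j / expected_degree n r \<psi> B j" if "i < n" "j < n" for i j
    using that label_less expected_degree_eq expected_adjacency_diag[OF B_bounds]
    by (simp add: J_diag_def class_mat_eq)
  then have "(\<lambda>(i, j). \<bar>J_diag n k r \<psi> B i / expected_degree n r \<psi> B i -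
      J_diag n k r \<psi> B j / expected_degree n r \<psi> B j\<bar>) ` ({..<n} \<times> {..<n}) =
      (\<lambda>_. 0) ` ({..<n} \<times> {..<n})"
    by (intro image_cong refl) (simp add: case_prod_beta mem_Times_iff)
  then have "(\<lambda>(i, j). \<bar>J_diag n k r \<psi> B i / expected_degree n r \<psi> B i -
      J_diag n k r \<psi> B j / expected_degree n r \<psi> B j\<bar>) ` ({..<n} \<times> {..<n}) = {0}"
    using n_pos by (simp add: image_constant_conv lessThan_empty_iff)
  moreover have "real n = real k * real s"
    using n_eq by (metis of_nat_mult)
  \<comment> \<open>By \<open>n = k * s\<close>, the factor \<open>s / d\<close> is
    \<open>n / (k * d)\<close>. If \<open>d = 0\<close>, both sides are 0, as division by zero
    yields 0.\<close>
  ultimately show ?thesis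
    unfolding delta_def using k_ge by simp
qed

lemma d_pos:
  assumes "0 < p" "r \<le> s"
  shows "0 < d"
  using assms q_nonneg \<alpha>_pos r_ge unfolding d_eq
  by (intro add_nonneg_pos mult_pos_pos) (auto simp: zero_less_binomial_iff)

text \<open>The condition \<open>r \<le> s\<close> says that an edge fits into a class. For smaller
  classes \<open>(s - 2) choose (r - 2)\<close> is 0 and so is \<open>delta\<close>.\<close>

lemma delta_pos:
  assumes "0 < p" "r \<le> s"
  shows "0 < delta n k r \<psi> B"
  unfolding delta_eq using assms d_pos[OF assms] \<alpha>_pos n_pos k_ge r_ge
  by (intro mult_pos_pos divide_pos_pos) (auto simp: zero_less_binomial_iff)

section \<open>Lower bound on \<open>delta^2 * d\<close>\<close>

lemma s_binomial_ge: "real r * (real r - 1) * real (s choose r) \<le> (real s)\<^sup>2 * real ((s - 2) choose (r - 2))"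
proof -
  obtain s' r' where s': "s = Suc (Suc s')" and r': "r = Suc (Suc r')"
    using s_ge r_ge by (metis Suc_le_D numeral_2_eq_2 Suc_le_mono)
  \<comment> \<open>Absorption applied twice: \<open>s * (s - 1) * ((s - 2) choose (r - 2)) = r * (r
    - 1) * (s choose r)\<close>.\<close>
  have "Suc (Suc s') * (Suc s' * (s' choose r')) =
      Suc (Suc s') * (Suc s' choose Suc r') * Suc r'"
    unfolding Suc_times_binomial_eq[of s' r'] by (rule mult.assoc[symmetric])
  also have "\<dots> = (Suc (Suc s') choose Suc (Suc r')) * Suc (Suc r') * Suc r'"
    unfolding Suc_times_binomial_eq[of "Suc s'" "Suc r'"] ..
  finally have "real (Suc (Suc s')) * (real (Suc s') * real (s' choose r')) =
      real (Suc (Suc s') choose Suc (Suc r')) * real (Suc (Suc r')) * real (Suc r')"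
    unfolding of_nat_mult[symmetric] by (simp only:)
  then have "real r * (real r - 1) * real (s choose r) =
      real s * (real s - 1) * real ((s - 2) choose (r - 2))"
    unfolding s' r' by (simp add: mult_ac del: binomial_Suc_Suc)
  also have "\<dots> \<le> real s * real s * real ((s - 2) choose (r - 2))"
    by (intro mult_right_mono mult_left_mono) auto
  finally show ?thesis by (simp add: power2_eq_square)
qed

text \<open>Enlarging the class to all nodes and using \<open>p + q \<le> 1\<close> bounds
  \<open>d\<close> by \<open>\<alpha>\<close> times the number of \<open>r\<close>-sets through a
  node; absorption rewrites \<open>n\<close> times that number as
  \<open>r * (n choose r)\<close>.\<close>

lemma d_le: "real n * d \<le> \<alpha> * real r * real (n choose r)"
proof -
  have "s \<le> n" by simp
  then have "real ((s - 1) choose (r - 1)) \<le> real ((n - 1) choose (r - 1))"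
    by (intro of_nat_mono binomial_right_mono diff_le_mono)
  then have "d \<le> \<alpha> * q * real ((n - 1) choose (r - 1)) + \<alpha> * p * real ((n - 1) choose (r - 1))"
    unfolding d_eq using \<alpha>_pos p_nonneg by (intro add_left_mono mult_left_mono) auto
  also have "\<dots> = (\<alpha> * real ((n - 1) choose (r - 1))) * (p + q)"
    by (simp add: algebra_simps)
  also have "\<dots> \<le> (\<alpha> * real ((n - 1) choose (r - 1))) * 1"
    using \<alpha>_pos pq_le by (intro mult_left_mono) auto
  finally have "real n * d \<le> real n * (\<alpha> * real ((n - 1) choose (r - 1)))"
    by (intro mult_left_mono) auto
  also have "\<dots> = \<alpha> * real (r * (n choose r))"
    using r_ge by (simp add: binomial_absorption[symmetric] times_binomial_minus1_eq)
  finally show ?thesis by simp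
qed

text \<open>By \<open>delta_eq\<close>,
  \<open>delta^2 * d = (p * \<alpha> * s * Y)^2 / (r^2 * d)\<close> with
  \<open>Y = (s - 2) choose (r - 2)\<close>, so \<open>Y\<close> is bounded from below by
  \<open>s_binomial_ge\<close> and \<open>ratio\<close>, and \<open>d\<close> from above by
  \<open>d_le\<close>. The constant \<open>8\<close> is \<open>4 * 2\<close>: the \<open>2\<close>
  of \<open>ratio\<close> squared, and the \<open>2\<close> of \<open>r \<le> 2 * (r - 1)^2\<close>,
  which absorbs the factor \<open>r\<close> coming from \<open>d_le\<close>.\<close>

lemma delta_sq_d_ge:
  assumes "0 < p" "r \<le> s"
    and ratio: "real (n choose r) \<le> 2 * real k ^ r * real (s choose r)"
  shows "p\<^sup>2 * \<alpha> * real (n choose r) / (8 * real k ^ (2 * r - 2) * real n)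
           \<le> (delta n k r \<psi> B)\<^sup>2 * d"
proof -
  define N Y D where "N = real (n choose r)" and "Y = real ((s - 2) choose (r - 2))" and "D = d"
  have n: "real n = real k * real s" using n_eq by (metis of_nat_mult)
  have pos: "0 < real k" "0 < real s" "0 < real n" "0 < real r" "1 \<le> real r - 1"
    using k_ge s_ge n_pos r_ge by auto
  have "s \<le> n" by simp
  then have "r \<le> n" using assms(2) by linarith
  then have N: "0 < N" by (simp add: N_def)
  have D: "0 < D" "real n * D \<le> \<alpha> * real r * N"
    using d_pos[OF assms(1,2)] d_le by (simp_all add: D_def N_def)
  have "real r * (real r - 1) * N \<le> real r * (real r - 1) * (2 * real k ^ r * real (s choose r))"
    using pos ratio by (intro mult_left_mono) (auto simp: N_def)
  also have "\<dots> = 2 * real k ^ r * (real r * (real r - 1) * real (s choose r))"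
    by simp
  also have "\<dots> \<le> 2 * real k ^ r * ((real s)\<^sup>2 * Y)"
    using s_binomial_ge by (intro mult_left_mono) (auto simp: Y_def)
  finally have Y: "real r * (real r - 1) * N \<le> 2 * real k ^ r * (real s)\<^sup>2 * Y"
    by (simp add: mult_ac)
  have "(real r * (real r - 1) * N)\<^sup>2 \<le> (2 * real k ^ r * (real s)\<^sup>2 * Y)\<^sup>2"
    using Y pos N by (intro power_mono) auto
  then have Y2: "(real r)\<^sup>2 * (real r - 1)\<^sup>2 * N\<^sup>2 \<le> 4 * real k ^ (2 * r) * (real s)^4 * Y\<^sup>2"
    by (simp add: power_mult_distrib power_mult[symmetric] mult.commute[of r 2])
  have r2: "real r \<le> 2 * (real r - 1)\<^sup>2"
  proof -
    have "real r \<le> 2 * (real r - 1)" using r_ge by simp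
    also have "\<dots> \<le> 2 * ((real r - 1) * (real r - 1))"
      using pos by (intro mult_left_mono) (auto simp: mult_le_cancel_left1)
    finally show ?thesis by (simp add: power2_eq_square)
  qed
  \<comment> \<open>The split-off \<open>k^2\<close> merges with \<open>s^2\<close> into
    \<open>n^2\<close>, which leaves the exponent \<open>2 * r - 2\<close> of the claim.\<close>
  have "2 * r = (2 * r - 2) + 2" using r_ge by simp
  then have k2: "real k ^ (2 * r) = real k ^ (2 * r - 2) * (real k)\<^sup>2"
    by (metis power_add)
  have delta: "delta n k r \<psi> B = p * \<alpha> * real s * Y / (real r * D)"
    unfolding delta_eq D_def Y_def n using pos by simp
  have lhs: "(delta n k r \<psi> B)\<^sup>2 * D = p\<^sup>2 * \<alpha>\<^sup>2 * (real s)\<^sup>2 * Y\<^sup>2 / ((real r)\<^sup>2 * D)"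
    unfolding delta using D(1) pos by (simp add: power2_eq_square mult_ac)
  \<comment> \<open>The estimate is proved with denominators cleared, inserting the bounds on
    \<open>D\<close>, on \<open>r\<close> and on \<open>N\<close> in turn; the common factor
    \<open>s^2\<close> and one factor \<open>n\<close> are cancelled afterwards.\<close>
  have "(real s)\<^sup>2 * ((real r)\<^sup>2 * N * (real n * D)) \<le> (real s)\<^sup>2 * ((real r)\<^sup>2 * N * (\<alpha> * real r * N))"
    using D N by (intro mult_left_mono) auto
  also have "\<dots> = (real s)\<^sup>2 * (\<alpha> * (real r)\<^sup>2 * N\<^sup>2) * real r"
    by (simp add: power2_eq_square mult_ac)
  also have "\<dots> \<le> (real s)\<^sup>2 * (\<alpha> * (real r)\<^sup>2 * N\<^sup>2) * (2 * (real r - 1)\<^sup>2)"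
    using r2 \<alpha>_pos by (intro mult_left_mono) auto
  also have "\<dots> = (real s)\<^sup>2 * (2 * \<alpha>) * ((real r)\<^sup>2 * (real r - 1)\<^sup>2 * N\<^sup>2)"
    by (simp add: mult_ac)
  also have "\<dots> \<le> (real s)\<^sup>2 * (2 * \<alpha>) * (4 * real k ^ (2 * r) * (real s)^4 * Y\<^sup>2)"
    using Y2 \<alpha>_pos by (intro mult_left_mono) auto
  also have "\<dots> = (real s)\<^sup>2 * (8 * \<alpha> * real k ^ (2 * r - 2) * (real n)\<^sup>2 * (real s)\<^sup>2 * Y\<^sup>2)"
    unfolding k2 n by (simp add: power2_eq_square power4_eq_xxxx mult_ac)
  finally have "(real r)\<^sup>2 * N * (real n * D) \<le>
      8 * \<alpha> * real k ^ (2 * r - 2) * (real n)\<^sup>2 * (real s)\<^sup>2 * Y\<^sup>2"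
    using pos by (simp add: mult_le_cancel_left_pos)
  also have "\<dots> = real n * (8 * \<alpha> * real k ^ (2 * r - 2) * real n * (real s)\<^sup>2 * Y\<^sup>2)"
    by (simp add: power2_eq_square mult_ac)
  finally have "real n * ((real r)\<^sup>2 * N * D) \<le>
      real n * (8 * \<alpha> * real k ^ (2 * r - 2) * real n * (real s)\<^sup>2 * Y\<^sup>2)"
    by (simp add: mult_ac)
  then have "(real r)\<^sup>2 * N * D \<le> 8 * \<alpha> * real k ^ (2 * r - 2) * real n * (real s)\<^sup>2 * Y\<^sup>2"
    using pos by (simp add: mult_le_cancel_left_pos)
  then have "(p\<^sup>2 * \<alpha>) * ((real r)\<^sup>2 * N * D) \<le>
      (p\<^sup>2 * \<alpha>) * (8 * \<alpha> * real k ^ (2 * r - 2) * real n * (real s)\<^sup>2 * Y\<^sup>2)"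
    using \<alpha>_pos by (intro mult_left_mono) auto
  then have "p\<^sup>2 * \<alpha> * N / (8 * real k ^ (2 * r - 2) * real n) \<le>
      p\<^sup>2 * \<alpha>\<^sup>2 * (real s)\<^sup>2 * Y\<^sup>2 / ((real r)\<^sup>2 * D)"
    using pos D(1) by (simp add: divide_le_eq le_divide_eq power2_eq_square mult_ac)
  then show ?thesis using lhs by (simp add: N_def D_def)
qed

end

text \<open>
  In the constant \<open>9 * C0 / p\<^sup>2\<close>, the factor \<open>9\<close> exceeds the \<open>8\<close> of \<open>delta_sq_d_ge\<close>, because the
  condition on \<open>d\<close> is strict.
\<close>

locale dense_two_level = balanced_two_level +
  fixes C0 :: real
  assumes C0_pos: "0 < C0" and p_pos: "0 < p" and r_le: "r \<le> s"
    and ln_n_pos: "0 < ln (real n)"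
    and ratio: "real (n choose r) \<le> 2 * real k ^ r * real (s choose r)"
    and dense: "9 * C0 / p\<^sup>2 * (real k ^ (2 * r - 1) * real n * (ln (real n))\<^sup>2 / real (n choose r)) \<le> \<alpha>"
begin

section \<open>Degree condition and error bound in the dense regime\<close>

lemma choose_pos: "0 < real (n choose r)"
proof -
  have "s \<le> n" by simp
  then show ?thesis using r_le by (simp add: order.trans)
qed

text \<open>One factor \<open>k\<close> is separated from \<open>k ^ (2 * r - 1)\<close>: it is the
  \<open>k\<close> of the degree condition, while the remaining power occurs in
  \<open>delta_sq_d_ge\<close> and in \<open>bound\<close>.\<close>

lemma dense_cleared: "9 * C0 * real k * (real k ^ (2 * r - 2) * real n * (ln (real n))\<^sup>2) \<le>
    p\<^sup>2 * \<alpha> * real (n choose r)"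
proof -
  have "2 * r - 1 = Suc (2 * r - 2)" using r_ge by simp
  then have "real k ^ (2 * r - 1) = real k * real k ^ (2 * r - 2)" by simp
  then show ?thesis
    using dense choose_pos p_pos by (simp add: divide_le_eq mult_ac)
qed

text \<open>Equal class sizes cancel, so the degree condition reads
  \<open>C0 * k * (ln n)^2 < delta^2 * d\<close>. It follows from \<open>dense_cleared\<close> and
  \<open>delta_sq_d_ge\<close>, whose constants have the quotient \<open>9 / 8\<close>.\<close>

lemma consistency: "consistency_conditions C0 n k r \<psi> B"
proof -
  let ?\<delta> = "delta n k r \<psi> B"
  have kn: "0 < 8 * real k ^ (2 * r - 2) * real n" using k_ge n_pos by simp
  have "0 < C0 * real k * (ln (real n))\<^sup>2" using C0_pos k_ge ln_n_pos by simp
  then have "C0 * real k * (ln (real n))\<^sup>2 < 9 / 8 * (C0 * real k * (ln (real n))\<^sup>2)" by simp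
  also have "\<dots> = 9 * C0 * real k * (real k ^ (2 * r - 2) * real n * (ln (real n))\<^sup>2) /
      (8 * real k ^ (2 * r - 2) * real n)"
    using k_ge n_pos by simp
  also have "\<dots> \<le> p\<^sup>2 * \<alpha> * real (n choose r) / (8 * real k ^ (2 * r - 2) * real n)"
    using dense_cleared kn by (intro divide_right_mono) auto
  also have "\<dots> \<le> ?\<delta>\<^sup>2 * d" by (rule delta_sq_d_ge[OF p_pos r_le ratio])
  finally have "C0 * real k * (ln (real n))\<^sup>2 < ?\<delta>\<^sup>2 * d" .
  moreover have "0 < ?\<delta>" by (rule delta_pos[OF p_pos r_le])
  moreover have "0 < s" using s_ge by simp
  ultimately show ?thesis
    unfolding consistency_conditions_def extreme_class_sizes
    by (simp add: divide_less_eq mult_ac)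
qed

abbreviation bound where
  "bound \<equiv> real k ^ (2 * r - 2) * (real n)\<^sup>2 * ln (real n) / (p\<^sup>2 * \<alpha> * real (n choose r))"

text \<open>Since \<open>k * s = n\<close>, the error term of the general theorem is
  \<open>n * ln n / (delta^2 * d)\<close>, and \<open>delta_sq_d_ge\<close> contributes the factor
  \<open>8\<close>.\<close>

lemma consistency_bound_le:
  "real k * real (max_class_size n k \<psi>) * ln (real n) / ((delta n k r \<psi> B)\<^sup>2 * d) \<le> 8 * bound"
proof -
  have pos: "0 < p\<^sup>2 * \<alpha> * real (n choose r) / (8 * real k ^ (2 * r - 2) * real n)"
    using p_pos \<alpha>_pos choose_pos k_ge n_pos by simp
  have "real n = real k * real s" using n_eq by (metis of_nat_mult)
  then have "real k * real (max_class_size n k \<psi>) * ln (real n) / ((delta n k r \<psi> B)\<^sup>2 * d)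
      = real n * ln (real n) / ((delta n k r \<psi> B)\<^sup>2 * d)"
    by (simp add: extreme_class_sizes)
  also have "\<dots> \<le> real n * ln (real n) /
      (p\<^sup>2 * \<alpha> * real (n choose r) / (8 * real k ^ (2 * r - 2) * real n))"
    using pos ln_n_pos delta_sq_d_ge[OF p_pos r_le ratio] delta_pos[OF p_pos r_le] d_pos[OF p_pos r_le]
    by (intro divide_left_mono mult_pos_pos) auto
  also have "\<dots> = 8 * bound" by (simp add: power2_eq_square)
  finally show ?thesis .
qed

lemma bound_le: "bound \<le> real n / (9 * C0 * ln (real n))"
proof -
  \<comment> \<open>The explicit factor \<open>1\<close> is raised to \<open>k\<close> in the next
    step, so that \<open>dense_cleared\<close> applies.\<close>
  have "real k ^ (2 * r - 2) * (real n)\<^sup>2 * ln (real n) * (9 * C0 * ln (real n))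
      = real n * (9 * C0 * 1 * (real k ^ (2 * r - 2) * real n * (ln (real n))\<^sup>2))"
    by (simp add: power2_eq_square)
  also have "\<dots> \<le> real n * (9 * C0 * real k * (real k ^ (2 * r - 2) * real n * (ln (real n))\<^sup>2))"
    using k_ge C0_pos by (intro mult_left_mono mult_right_mono) auto
  also have "\<dots> \<le> real n * (p\<^sup>2 * \<alpha> * real (n choose r))"
    using dense_cleared by (intro mult_left_mono) auto
  finally show ?thesis
    using p_pos \<alpha>_pos choose_pos C0_pos ln_n_pos
    by (simp add: divide_le_eq le_divide_eq mult_ac)
qed

lemma bound_nonneg: "0 \<le> bound"
  using \<alpha>_pos ln_n_pos by simp

end

section \<open>Binomial asymptotics and growth of the class size\<close>

lemma eventually_power_le_binomial:
  "\<forall>\<^sub>F s in sequentially. real s ^ r \<le> 2 * (fact r * real (s choose r))"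
proof -
  \<comment> \<open>The falling factorial \<open>fact r * (s choose r)\<close> is at least
    \<open>(s - r)^r = s^r * (1 - r / s)^r\<close>, and for fixed \<open>r\<close> the last factor
    tends to 1.\<close>
  have "((\<lambda>s. (1 - real r / real s) ^ r) \<longlongrightarrow> (1 - 0) ^ r) sequentially"
    by (intro tendsto_intros lim_const_over_n)
  then have "\<forall>\<^sub>F s in sequentially. 1 / 2 < (1 - real r / real s) ^ r"
    by (rule order_tendstoD) simp
  then show ?thesis
    using eventually_ge_at_top[of "max 1 r"]
  proof eventually_elim
    case (elim s)
    then have s: "0 < real s" "real r \<le> real s" by auto
    have "real s ^ r * (1 / 2) \<le> real s ^ r * (1 - real r / real s) ^ r"
      using elim by (intro mult_left_mono) auto
    also have "\<dots> = (real s - real r) ^ r"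
      using s by (simp add: power_mult_distrib[symmetric] right_diff_distrib)
    also have "\<dots> = (\<Prod>i=0..<r. real s - real r)" by simp
    also have "\<dots> \<le> (\<Prod>i=0..<r. real s - real i)"
      using s by (intro prod_mono) auto
    also have "\<dots> = fact r * real (s choose r)"
      by (simp add: gbinomial_mult_fact binomial_gbinomial)
    finally show ?case by simp
  qed
qed

text \<open>Compares \<open>fact r * (k * s choose r) \<le> (k * s)^r\<close> with the preceding
  bound on \<open>s^r\<close>. The threshold for \<open>s\<close> is uniform in \<open>k\<close>, as
  it must be when \<open>k\<close> varies with \<open>n\<close>.\<close>

lemma eventually_binomial_mult_le:
  "\<forall>\<^sub>F s in sequentially. \<forall>k. real (k * s choose r) \<le> 2 * real k ^ r * real (s choose r)"
  using eventually_power_le_binomial[of r]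
proof eventually_elim
  case (elim s)
  show ?case
  proof
    fix k
    have "fact r * real (k * s choose r) = real ((k * s choose r) * fact r)" by simp
    also have "\<dots> \<le> real ((k * s) ^ r)" by (intro of_nat_mono binomial_fact_pow)
    also have "\<dots> = real k ^ r * real s ^ r" by (simp add: power_mult_distrib)
    also have "\<dots> \<le> real k ^ r * (2 * (fact r * real (s choose r)))"
      using elim by (intro mult_left_mono) auto
    also have "\<dots> = fact r * (2 * real k ^ r * real (s choose r))" by simp
    finally show "real (k * s choose r) \<le> 2 * real k ^ r * real (s choose r)"
      by (simp add: mult_le_cancel_left_pos)
  qed
qed

text \<open>Because \<open>\<alpha> \<le> 1\<close>, the density bound forces \<open>C * k^(2 * r -
  1) * n * (ln n)^2 \<le> (n choose r) \<le> n^r\<close>. With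
  \<open>n^r = n * k^(r - 1) * s^(r - 1)\<close> and \<open>k^(r - 1) \<le> k^(2 * r - 1)\<close>
  this leaves \<open>C * (ln n)^2 \<le> s^(r - 1)\<close>, so \<open>s\<close> grows however
  \<open>k\<close> varies.\<close>

lemma class_size_at_top:
  fixes n k :: "nat \<Rightarrow> nat" and \<alpha> :: "nat \<Rightarrow> real"
  assumes "0 < C" "1 \<le> r" and n: "filterlim n at_top sequentially"
    and k: "\<And>m. 1 \<le> k m" "\<And>m. k m dvd n m"
    and \<alpha>: "\<And>m. \<alpha> m \<le> 1"
      "\<And>m. C * (real (k m) ^ (2 * r - 1) * real (n m) * (ln (real (n m)))\<^sup>2 /
              real (n m choose r)) \<le> \<alpha> m"
  shows "filterlim (\<lambda>m. n m div k m) at_top sequentially"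
  unfolding filterlim_at_top
proof
  fix S :: nat
  have "filterlim (\<lambda>m. C * (ln (real (n m)))\<^sup>2) at_top sequentially"
    using assms(1) n
    by (intro filterlim_tendsto_pos_mult_at_top[OF tendsto_const] filterlim_pow_at_top
          filterlim_compose[OF ln_at_top] filterlim_compose[OF filterlim_real_sequentially]) auto
  then have "\<forall>\<^sub>F m in sequentially. real S ^ (r - 1) < C * (ln (real (n m)))\<^sup>2"
    by (simp add: filterlim_at_top_dense)
  moreover have "\<forall>\<^sub>F m in sequentially. max 1 r \<le> n m"
    using n unfolding filterlim_at_top by blast
  ultimately show "\<forall>\<^sub>F m in sequentially. S \<le> n m div k m"
  proof eventually_elim
    case (elim m)
    define s where "s = n m div k m"
    have pos: "0 < real (n m)" "0 < real (k m)" "0 < real (n m choose r)"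
      using elim(2) k(1)[of m] by auto
    have ns: "real (n m) = real (k m) * real s"
      using k(2)[of m] unfolding s_def by (metis dvd_mult_div_cancel of_nat_mult)
    have "real (k m) ^ (r - 1) * (C * (ln (real (n m)))\<^sup>2) \<le>
        real (k m) ^ (2 * r - 1) * (C * (ln (real (n m)))\<^sup>2)"
      using k(1)[of m] assms(1) by (intro mult_right_mono power_increasing) auto
    then have "real (n m) * (real (k m) ^ (r - 1) * (C * (ln (real (n m)))\<^sup>2)) \<le>
        real (n m) * (real (k m) ^ (2 * r - 1) * (C * (ln (real (n m)))\<^sup>2))"
      by (intro mult_left_mono) auto
    also have "C * (real (k m) ^ (2 * r - 1) * real (n m) * (ln (real (n m)))\<^sup>2 /
              real (n m choose r)) \<le> 1"
      using \<alpha>[of m] by linarith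
    then have "real (n m) * (real (k m) ^ (2 * r - 1) * (C * (ln (real (n m)))\<^sup>2)) \<le>
        real (n m choose r)"
      using pos by (simp add: divide_le_eq mult_ac)
    also have "real (n m choose r) \<le> real (n m ^ r)"
      using elim(2) by (intro of_nat_mono binomial_le_pow) simp
    also have "\<dots> = real (n m) * real (n m) ^ (r - 1)"
      using assms(2) by (cases r) simp_all
    also have "\<dots> = real (n m) * (real (k m) ^ (r - 1) * real s ^ (r - 1))"
      unfolding ns by (simp add: power_mult_distrib)
    finally have "C * (ln (real (n m)))\<^sup>2 \<le> real s ^ (r - 1)"
      using pos by (simp add: mult_le_cancel_left_pos)
    with elim(1) have "real S ^ (r - 1) < real s ^ (r - 1)" by linarith
    then have "real S < real s" by (rule power_less_imp_less_base) simp
    then show ?case by (simp add: s_def)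
  qed
qed

text \<open>Asymptotics are stated along sequences of models indexed by \<open>m\<close> with
  \<open>n m\<close> tending to infinity, so that \<open>k\<close> and \<open>\<alpha>\<close> may
  vary while \<open>p\<close>, \<open>q\<close> and \<open>r\<close> stay fixed. The general theorem
  enters as a hypothesis of the last claim, with the same \<open>C0\<close> as in the
  conditions.\<close>

theorem corollary5p1:
  shows
    "(\<forall>(n::nat) (k::nat) (r::nat) (p::real) (q::real) (\<alpha>::real) (\<psi>::nat \<Rightarrow> nat).
        2 \<le> k \<and> 2 \<le> r \<and> 2 \<le> n div k \<and> balanced_partition n k \<psi> \<and>
        0 \<le> p \<and> 0 \<le> q \<and> p + q \<le> 1 \<and> 0 < \<alpha> \<and> \<alpha> \<le> 1 \<longrightarrow>
        (let B = two_level_prob p q \<alpha>; d = min_expected_degree n r \<psi> B in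
          delta n k r \<psi> B =
            p * \<alpha> * real n / (real r * real k * d) * real ((n div k - 2) choose (r - 2)) \<and>
          (0 < p \<and> r \<le> n div k \<longrightarrow> delta n k r \<psi> B > 0)))
     \<and>
     (\<forall>(C0::real) (p::real). 0 < C0 \<and> 0 < p \<and> p \<le> 1 \<longrightarrow>
       (\<exists>C>0. \<forall>(q::real) (r::nat) (n::nat \<Rightarrow> nat) (k::nat \<Rightarrow> nat) (\<alpha>::nat \<Rightarrow> real)
           (\<psi>::nat \<Rightarrow> nat \<Rightarrow> nat).
         0 \<le> q \<and> p + q \<le> 1 \<and> 2 \<le> r \<and> filterlim n at_top sequentially \<and>
         (\<forall>m. 2 \<le> k m \<and> balanced_partition (n m) (k m) (\<psi> m) \<and> 0 < \<alpha> m \<and> \<alpha> m \<le> 1 \<and>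
              \<alpha> m \<ge> C * (real (k m) ^ (2 * r - 1) * real (n m) * (ln (real (n m)))\<^sup>2 /
                         real (n m choose r))) \<longrightarrow>
         (let B = (\<lambda>m. two_level_prob p q (\<alpha> m));
              bound = (\<lambda>m. real (k m) ^ (2 * r - 2) * (real (n m))\<^sup>2 * ln (real (n m)) /
                           (p\<^sup>2 * \<alpha> m * real (n m choose r)))
          in
            (\<forall>\<^sub>F m in sequentially. consistency_conditions C0 (n m) (k m) r (\<psi> m) (B m)) \<and>
            bound \<in> o(\<lambda>m. real (n m)) \<and>
            (general_consistency_theorem C0 \<longrightarrow>
              (\<forall>km eig. kmeans_guarantee km \<and> eigenvector_method eig \<longrightarrow>
                (\<exists>K>0. (\<lambda>m. measure_pmf.prob
                            (output_labelling eig km (n m) (k m) r (\<psi> m) (B m))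
                            {\<psi>'. real (Err (n m) (k m) (\<psi> m) \<psi>') \<le> K * bound m})
                        \<longlonglongrightarrow> 1))))))"
proof (intro conjI allI impI)

  \<comment> \<open>A single model: formula for \<open>delta\<close> and identifiability\<close>
  fix n k r :: nat and p q \<alpha> :: real and \<psi> :: "nat \<Rightarrow> nat"
  assume "2 \<le> k \<and> 2 \<le> r \<and> 2 \<le> n div k \<and> balanced_partition n k \<psi> \<and>
    0 \<le> p \<and> 0 \<le> q \<and> p + q \<le> 1 \<and> 0 < \<alpha> \<and> \<alpha> \<le> 1"
  then interpret balanced_two_level n k r p q \<alpha> \<psi>
    by unfold_locales auto
  show "let B = two_level_prob p q \<alpha>; d = min_expected_degree n r \<psi> B in
      delta n k r \<psi> B =
        p * \<alpha> * real n / (real r * real k * d) * real ((n div k - 2) choose (r - 2)) \<and>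
      (0 < p \<and> r \<le> n div k \<longrightarrow> delta n k r \<psi> B > 0)"
    unfolding Let_def using delta_eq delta_pos by blast
next

  \<comment> \<open>Sequences of models: conditions, error bound and probability\<close>
  fix C0 p :: real
  assume Cp: "0 < C0 \<and> 0 < p \<and> p \<le> 1"
  \<comment> \<open>The factor demanded by \<open>dense_two_level\<close>; it depends on
    \<open>C0\<close> and \<open>p\<close> alone and so precedes \<open>q\<close>, \<open>r\<close>
    and the sequences.\<close>
  define C where "C = 9 * C0 / p\<^sup>2"
  have C_pos: "0 < C" using Cp by (simp add: C_def)
  show "\<exists>C>0. \<forall>(q::real) (r::nat) (n::nat \<Rightarrow> nat) (k::nat \<Rightarrow> nat) (\<alpha>::nat \<Rightarrow> real)
           (\<psi>::nat \<Rightarrow> nat \<Rightarrow> nat).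
         0 \<le> q \<and> p + q \<le> 1 \<and> 2 \<le> r \<and> filterlim n at_top sequentially \<and>
         (\<forall>m. 2 \<le> k m \<and> balanced_partition (n m) (k m) (\<psi> m) \<and> 0 < \<alpha> m \<and> \<alpha> m \<le> 1 \<and>
              \<alpha> m \<ge> C * (real (k m) ^ (2 * r - 1) * real (n m) * (ln (real (n m)))\<^sup>2 /
                         real (n m choose r))) \<longrightarrow>
         (let B = (\<lambda>m. two_level_prob p q (\<alpha> m));
              bound = (\<lambda>m. real (k m) ^ (2 * r - 2) * (real (n m))\<^sup>2 * ln (real (n m)) /
                           (p\<^sup>2 * \<alpha> m * real (n m choose r)))
          in
            (\<forall>\<^sub>F m in sequentially. consistency_conditions C0 (n m) (k m) r (\<psi> m) (B m)) \<and>
            bound \<in> o(\<lambda>m. real (n m)) \<and>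
            (general_consistency_theorem C0 \<longrightarrow>
              (\<forall>km eig. kmeans_guarantee km \<and> eigenvector_method eig \<longrightarrow>
                (\<exists>K>0. (\<lambda>m. measure_pmf.prob
                            (output_labelling eig km (n m) (k m) r (\<psi> m) (B m))
                            {\<psi>'. real (Err (n m) (k m) (\<psi> m) \<psi>') \<le> K * bound m})
                        \<longlonglongrightarrow> 1))))"
    unfolding Let_def
  proof (intro exI[of _ C] conjI[OF C_pos] allI impI, elim conjE)
    fix q :: real and r :: nat and n k :: "nat \<Rightarrow> nat" and \<alpha> :: "nat \<Rightarrow> real"
      and \<psi> :: "nat \<Rightarrow> nat \<Rightarrow> nat"
    assume q: "0 \<le> q" "p + q \<le> 1" and r: "2 \<le> r" and n: "filterlim n at_top sequentially"
      and model: "\<forall>m. 2 \<le> k m \<and> balanced_partition (n m) (k m) (\<psi> m) \<and> 0 < \<alpha> m \<and> \<alpha> m \<le> 1 \<and>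
              \<alpha> m \<ge> C * (real (k m) ^ (2 * r - 1) * real (n m) * (ln (real (n m)))\<^sup>2 /
                         real (n m choose r))"
    define B where "B m = two_level_prob p q (\<alpha> m)" for m
    define bound where "bound m = real (k m) ^ (2 * r - 2) * (real (n m))\<^sup>2 * ln (real (n m)) /
                           (p\<^sup>2 * \<alpha> m * real (n m choose r))" for m
    have dvd: "k m dvd n m" for m using model by (auto simp: balanced_partition_def)
    have ln_n: "filterlim (\<lambda>m. ln (real (n m))) at_top sequentially"
      using n by (intro filterlim_compose[OF ln_at_top] filterlim_compose[OF filterlim_real_sequentially])
    have "1 \<le> k m" for m using model[rule_format, of m] by linarith
    then have s: "filterlim (\<lambda>m. n m div k m) at_top sequentially"
      using model r dvd by (intro class_size_at_top[OF C_pos _ n, of r k \<alpha>]) auto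
    have "\<forall>\<^sub>F m in sequentially. max 2 r \<le> n m div k m"
      using s unfolding filterlim_at_top by blast
    moreover have "\<forall>\<^sub>F m in sequentially. 0 < ln (real (n m))"
      using ln_n by (simp add: filterlim_at_top_dense)
    moreover have "\<forall>\<^sub>F m in sequentially. \<forall>j. real (j * (n m div k m) choose r) \<le>
        2 * real j ^ r * real (n m div k m choose r)"
      using eventually_compose_filterlim[OF eventually_binomial_mult_le s] .
    \<comment> \<open>Growth of the class size has supplied both \<open>r \<le> s\<close> and
      \<open>ratio\<close>, so the finite estimates apply to all late models.\<close>
    ultimately have dense: "\<forall>\<^sub>F m in sequentially. dense_two_level (n m) (k m) r p q (\<alpha> m) (\<psi> m) C0"
    proof eventually_elim
      case (elim m)
      have "real (n m choose r) \<le> 2 * real (k m) ^ r * real (n m div k m choose r)"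
        using elim(3)[rule_format, of "k m"] dvd[of m] by simp
      then show ?case
        using elim(1,2) model[rule_format, of m] q r Cp by unfold_locales (auto simp: C_def)
    qed
    have cons: "\<forall>\<^sub>F m in sequentially. consistency_conditions C0 (n m) (k m) r (\<psi> m) (B m)"
      using dense unfolding B_def by eventually_elim (rule dense_two_level.consistency)
    have "bound \<in> o(\<lambda>m. real (n m))"
    proof (rule landau_o.smallI)
      fix c :: real
      assume c: "0 < c"
      have "\<forall>\<^sub>F m in sequentially. 1 / (9 * C0 * c) \<le> ln (real (n m))"
        using ln_n by (simp add: filterlim_at_top)
      \<comment> \<open>Once \<open>ln n\<close> exceeds \<open>1 / (9 * C0 * c)\<close>, the
        estimate \<open>bound_le\<close> is at most \<open>c * n\<close>.\<close>
      with dense show "\<forall>\<^sub>F m in sequentially. norm (bound m) \<le> c * norm (real (n m))"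
      proof eventually_elim
        case (elim m)
        then interpret dense_two_level "n m" "k m" r p q "\<alpha> m" "\<psi> m" C0 by simp
        have "1 / (9 * C0 * ln (real (n m))) \<le> c"
          using elim(2) c C0_pos ln_n_pos by (simp add: divide_le_eq mult_ac)
        then have "real (n m) * (1 / (9 * C0 * ln (real (n m)))) \<le> real (n m) * c"
          by (intro mult_left_mono) auto
        then have "bound m \<le> real (n m) * c" using bound_le unfolding bound_def by simp
        moreover have "0 \<le> bound m" using bound_nonneg unfolding bound_def .
        ultimately show ?case by (simp add: mult.commute)
      qed
    qed
    moreover have "\<exists>K>0. (\<lambda>m. measure_pmf.prob
        (output_labelling eig km (n m) (k m) r (\<psi> m) (B m))
        {\<psi>'. real (Err (n m) (k m) (\<psi> m) \<psi>') \<le> K * bound m}) \<longlonglongrightarrow> 1"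
      if gen: "general_consistency_theorem C0" and km: "kmeans_guarantee km"
        and eig: "eigenvector_method eig" for km eig
    proof -
      \<comment> \<open>These constants depend on \<open>km\<close> only, hence serve all models of
        the sequence at once.\<close>
      from gen km obtain K K' N where K: "0 < K" and
        prob: "\<And>n k r \<psi> B eig. N \<le> n \<Longrightarrow>
          1 \<le> k \<and> 2 \<le> r \<and> \<psi> ` {..<n} = {..<k} \<and> (\<forall>M. 0 \<le> B M \<and> B M \<le> 1) \<and>
          eigenvector_method eig \<and> consistency_conditions C0 n k r \<psi> B \<Longrightarrow>
          measure_pmf.prob (output_labelling eig km n k r \<psi> B)
            {\<psi>'. real (Err n k \<psi> \<psi>') \<le>
                   K * (real k * real (max_class_size n k \<psi>) * ln (real n) /
                        ((delta n k r \<psi> B)\<^sup>2 * min_expected_degree n r \<psi> B))}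
          \<ge> 1 - K' * ln (real n) powr (- 1 / 4)"
        unfolding general_consistency_theorem_def by metis
      let ?P = "\<lambda>m. measure_pmf.prob (output_labelling eig km (n m) (k m) r (\<psi> m) (B m))
        {\<psi>'. real (Err (n m) (k m) (\<psi> m) \<psi>') \<le> 8 * K * bound m}"
      have "\<forall>\<^sub>F m in sequentially. N \<le> n m" using n by (simp add: filterlim_at_top)
      with dense have lower: "\<forall>\<^sub>F m in sequentially.
          1 - K' * ln (real (n m)) powr (- 1 / 4) \<le> ?P m"
      proof eventually_elim
        case (elim m)
        then interpret dense_two_level "n m" "k m" r p q "\<alpha> m" "\<psi> m" C0 by simp
        have "1 - K' * ln (real (n m)) powr (- 1 / 4) \<le>
          measure_pmf.prob (output_labelling eig km (n m) (k m) r (\<psi> m) (B m))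
            {\<psi>'. real (Err (n m) (k m) (\<psi> m) \<psi>') \<le>
                   K * (real (k m) * real (max_class_size (n m) (k m) (\<psi> m)) * ln (real (n m)) /
                        ((delta (n m) (k m) r (\<psi> m) (B m))\<^sup>2 *
                          min_expected_degree (n m) r (\<psi> m) (B m)))}"
          using elim(2) k_ge r_ge labels_surj B_bounds eig consistency
          by (intro prob) (auto simp: B_def)
        also have "\<dots> \<le> ?P m"
        proof (intro measure_pmf.finite_measure_mono subsetI)
          fix \<psi>' assume "\<psi>' \<in> {\<psi>'. real (Err (n m) (k m) (\<psi> m) \<psi>') \<le>
                   K * (real (k m) * real (max_class_size (n m) (k m) (\<psi> m)) * ln (real (n m)) /
                        ((delta (n m) (k m) r (\<psi> m) (B m))\<^sup>2 *
                          min_expected_degree (n m) r (\<psi> m) (B m)))}"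
          moreover have "K * (real (k m) * real (max_class_size (n m) (k m) (\<psi> m)) * ln (real (n m)) /
                        ((delta (n m) (k m) r (\<psi> m) (B m))\<^sup>2 *
                          min_expected_degree (n m) r (\<psi> m) (B m))) \<le> K * (8 * bound m)"
            using K consistency_bound_le unfolding B_def bound_def by (intro mult_left_mono) auto
          ultimately show "\<psi>' \<in> {\<psi>'. real (Err (n m) (k m) (\<psi> m) \<psi>') \<le> 8 * K * bound m}"
            by simp
        qed simp
        finally show ?case .
      qed
      have "((\<lambda>m. 1 - K' * ln (real (n m)) powr (- 1 / 4)) \<longlongrightarrow> 1 - K' * 0) sequentially"
        by (intro tendsto_intros tendsto_neg_powr ln_n) simp
      \<comment> \<open>The lower bound tends to 1 because \<open>ln n\<close> tends to infinity and
        its exponent is negative; the upper bound is 1.\<close>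
      then have "?P \<longlonglongrightarrow> 1"
        by (intro tendsto_sandwich[OF lower _ _ tendsto_const]) auto
      then show ?thesis using K by (intro exI[of _ "8 * K"]) simp
    qed
    ultimately show "(\<forall>\<^sub>F m in sequentially.
          consistency_conditions C0 (n m) (k m) r (\<psi> m) (two_level_prob p q (\<alpha> m))) \<and>
        (\<lambda>m. real (k m) ^ (2 * r - 2) * (real (n m))\<^sup>2 * ln (real (n m)) /
                           (p\<^sup>2 * \<alpha> m * real (n m choose r))) \<in> o(\<lambda>m. real (n m)) \<and>
        (general_consistency_theorem C0 \<longrightarrow>
              (\<forall>km eig. kmeans_guarantee km \<and> eigenvector_method eig \<longrightarrow>
                (\<exists>K>0. (\<lambda>m. measure_pmf.prob
                            (output_labelling eig km (n m) (k m) r (\<psi> m) (two_level_prob p q (\<alpha> m)))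
                            {\<psi>'. real (Err (n m) (k m) (\<psi> m) \<psi>') \<le>
                              K * (real (k m) ^ (2 * r - 2) * (real (n m))\<^sup>2 * ln (real (n m)) /
                           (p\<^sup>2 * \<alpha> m * real (n m choose r)))})
                        \<longlonglongrightarrow> 1)))"
      using cons unfolding B_def bound_def by blast
  qed
qed

end
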